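(* Let $a,b,c$ be constants and $F(x)=ax+bx^2+cx^3$. Then for all integers $n\geq k\geq 1$ the composita of $F(x)$ is $$F^{\Delta}(n,k)=\sum_{j=0}^{k}\binom{k}{j}\binom{j}{n-k-j}a^{k-j}b^{2j+k-n}c^{n-k-j}.$$
   Context: Generating functions are formal power series over a field of characteristic zero (e.g. $\mathbb{C}$). For a generating function $F(x)=\sum_{n>0}f(n)x^n$ with zero constant term, its composita is the function of two variables $F^{\Delta}(n,k)=\sum f(\lambda_1)f(\lambda_2)\cdots f(\lambda_k)$, the sum being over all compositions $(\lambda_1,\dots,\lambda_k)$ of $n$ into $k$ parts (positive integers $\lambda_i$ with $\lambda_1+\cdots+\lambda_k=n$); equivalently $F^{\Delta}(n,k)=[x^n]F(x)^k$ for $k\geq 1$. Conventions: $\binom{p}{q}=0$ for integers $p\ge 0$ and $q<0$ or $q>p$, a term containing a zero binomial coefficient is $0$, and $0^0=1$. *)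

theory Defs
  imports "HOL-Computational_Algebra.Formal_Power_Series"
begin

definition compositions :: "nat \<Rightarrow> nat \<Rightarrow> nat list set" where
  "compositions n k = {xs. length xs = k \<and> (\<forall>x\<in>set xs. 0 < x) \<and> sum_list xs = n}"

(* Needed because a sum over an infinite index set would silently be 0. *)
lemma finite_compositions: "finite (compositions n k)"
proof (rule finite_subset)
  show "compositions n k \<subseteq> {xs. set xs \<subseteq> {..n} \<and> length xs = k}"
    by (auto simp: compositions_def intro: member_le_sum_list)
  show "finite {xs. set xs \<subseteq> {..n} \<and> length xs = k}"
    by (intro finite_lists_length_eq) simp
qed

definition composita :: "'a::comm_ring_1 fps \<Rightarrow> nat \<Rightarrow> nat \<Rightarrow> 'a" where
  "composita F n k = (\<Sum>xs\<in>compositions n k. \<Prod>m\<leftarrow>xs. fps_nth F m)"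

(* Binomial coefficient with an integer lower index. On nat the difference n - k - j
   would truncate to 0 and give the value 1 where the convention requires 0. *)
definition int_choose :: "nat \<Rightarrow> int \<Rightarrow> nat" where
  "int_choose p q = (if q < 0 then 0 else p choose nat q)"

end

theory Submission
  imports Defs
begin

text \<open>
  The composita of a series \<open>F\<close> without constant term is the coefficient of \<open>x\<^sup>n\<close> in \<open>F\<^sup>k\<close>,
  so it suffices to expand a power of the cubic. Factoring it as in Horner's scheme,
  \<open>F = x (a + x (b + c x))\<close>, makes two nested binomial expansions possible:
  the outer one gives the sum over \<open>j\<close> with the powers \<open>a\<^bsup>k-j\<^esup>\<close> and the shift by \<open>x\<^bsup>k+j\<^esup>\<close>,
  and what remains is a single coefficient of \<open>(b + c x)\<^sup>j\<close>, at the index \<open>n - k - j\<close>.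
  The integer conventions of the formula are exactly what makes the terms with
  \<open>n - k - j < 0\<close> (shift too large) or \<open>n - k - j > j\<close> (degree too small) vanish.
\<close>

text \<open>
  The power coefficient is a sum over all lists of naturals, zeros included. A list with a
  zero entry contributes the factor \<open>F $ 0 = 0\<close>, which leaves the compositions.
\<close>
lemma composita_eq_fps_nth_power:
  fixes F :: "'a::comm_ring_1 fps"
  assumes "fps_nth F 0 = 0" and "1 \<le> k"
  shows "composita F n k = fps_nth (F ^ k) n"
proof -
  have sub: "compositions n k \<subseteq> natpermute n k"
    by (auto simp: compositions_def natpermute_def)
  have zero: "(\<Prod>m\<leftarrow>xs. fps_nth F m) = 0" if "xs \<in> natpermute n k - compositions n k" for xs
  proof -
    from that have "0 \<in> set xs"
      by (auto simp: compositions_def natpermute_def)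
    then have "fps_nth F 0 \<in> set (map (fps_nth F) xs)"
      by simp
    then show ?thesis
      using assms(1) by (induction xs) auto
  qed
  have nth: "(\<Prod>m\<leftarrow>xs. fps_nth F m) = (\<Prod>i=0..k - 1. fps_nth F (xs ! i))"
    if "xs \<in> natpermute n k" for xs
  proof -
    from that have "length xs = k"
      by (simp add: natpermute_def)
    moreover have "{0..<k} = {0..k - 1}"
      using \<open>1 \<le> k\<close> by auto
    ultimately show ?thesis
      by (auto simp: prod.list_conv_set_nth intro!: prod.cong)
  qed
  have "composita F n k = (\<Sum>xs\<in>natpermute n k. \<Prod>m\<leftarrow>xs. fps_nth F m)"
    unfolding composita_def
    using sub zero by (intro sum.mono_neutral_left) (auto simp: natpermute_finite)
  also have "\<dots> = fps_nth (F ^ k) n"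
    using \<open>1 \<le> k\<close> nth by (simp add: fps_power_nth)
  finally show ?thesis .
qed

lemma fps_nth_linear_power:
  fixes b c :: "'a::comm_ring_1"
  shows "fps_nth ((fps_const b + fps_const c * fps_X) ^ j) m
    = of_nat (j choose m) * b ^ (j - m) * c ^ m"
proof -
  have "(fps_const b + fps_const c * fps_X) ^ j
      = (\<Sum>i\<le>j. fps_const (of_nat (j choose i) * c ^ i * b ^ (j - i)) * fps_X ^ i)"
    unfolding add.commute[of "fps_const b"] binomial_ring
    by (simp add: power_mult_distrib fps_const_power fps_of_nat[symmetric] mult_ac
        flip: fps_const_mult)
  then show ?thesis
    by (simp add: fps_sum_nth mult_delta_right binomial_eq_0 mult_ac)
qed

text \<open>
  The expansion is the binomial theorem for \<open>x (b + c x)\<close> and \<open>a\<close>, where the \<open>j\<close>-th term carries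
  the total factor \<open>x\<^bsup>k+j\<^esup>\<close>. With natural subtraction the case \<open>k + j > n\<close>, in which
  the coefficient is zero, has to be singled out by the conditional.
\<close>
lemma fps_nth_cubic_power:
  fixes a b c :: "'a::comm_ring_1"
  assumes "k \<le> n"
  shows "fps_nth ((fps_const a * fps_X + fps_const b * fps_X ^ 2 + fps_const c * fps_X ^ 3) ^ k) n
    = (\<Sum>j\<le>k. if n - k < j then 0 else
         of_nat (k choose j) * a ^ (k - j)
         * (of_nat (j choose (n - k - j)) * b ^ (j - (n - k - j)) * c ^ (n - k - j)))"
proof -
  let ?L = "fps_const b + fps_const c * fps_X"
  have horner: "fps_const a * fps_X + fps_const b * fps_X ^ 2 + fps_const c * fps_X ^ 3
      = fps_X * (fps_X * ?L + fps_const a)"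
    by (simp add: algebra_simps power2_eq_square power3_eq_cube)
  have expand: "(fps_X * ?L + fps_const a) ^ k
      = (\<Sum>j\<le>k. fps_X ^ j * (fps_const (of_nat (k choose j) * a ^ (k - j)) * ?L ^ j))"
    unfolding binomial_ring[of "fps_X * ?L"]
    by (simp add: power_mult_distrib fps_const_power fps_of_nat[symmetric] mult_ac
        flip: fps_const_mult)
  show ?thesis
    unfolding horner power_mult_distrib expand
    using assms by (auto simp: fps_X_power_mult_nth fps_sum_nth fps_nth_linear_power
        intro!: sum.cong)
qed

theorem mainTheorem3:
  fixes a b c :: "'a::field_char_0" and F :: "'a fps" and n k :: nat
  assumes F: "F = fps_const a * fps_X + fps_const b * fps_X ^ 2 + fps_const c * fps_X ^ 3"
    and "1 \<le> k" and "k \<le> n"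
  shows "composita F n k =
    (\<Sum>j=0..k. of_nat (k choose j) * of_nat (int_choose j (int n - int k - int j))
       * a ^ (k - j) * b powi (2 * int j + int k - int n) * c powi (int n - int k - int j))"
proof -
  have "fps_nth F 0 = 0"
    by (simp add: F)
  then have "composita F n k = fps_nth (F ^ k) n"
    using \<open>1 \<le> k\<close> by (rule composita_eq_fps_nth_power)
  also have "\<dots> = (\<Sum>j\<le>k. if n - k < j then 0 else
         of_nat (k choose j) * a ^ (k - j)
         * (of_nat (j choose (n - k - j)) * b ^ (j - (n - k - j)) * c ^ (n - k - j)))"
    unfolding F using \<open>k \<le> n\<close> by (rule fps_nth_cubic_power)
  also have "\<dots> = (\<Sum>j=0..k. of_nat (k choose j) * of_nat (int_choose j (int n - int k - int j))
       * a ^ (k - j) * b powi (2 * int j + int k - int n) * c powi (int n - int k - int j))"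
    unfolding atLeast0AtMost
  proof (rule sum.cong[OF refl])
    fix j
    show "(if n - k < j then 0 else
         of_nat (k choose j) * a ^ (k - j)
         * (of_nat (j choose (n - k - j)) * b ^ (j - (n - k - j)) * c ^ (n - k - j)))
      = of_nat (k choose j) * of_nat (int_choose j (int n - int k - int j))
       * a ^ (k - j) * b powi (2 * int j + int k - int n) * c powi (int n - int k - int j)"
    proof (cases "j \<le> n - k")
      case False
      then have "int n - int k - int j < 0"
        using \<open>k \<le> n\<close> by linarith
      with False show ?thesis
        by (simp add: int_choose_def)
    next
      case True
      define m where "m = n - (k + j)"
      have m: "int n - int k - int j = int m" "2 * int j + int k - int n = int j - int m"
        using True \<open>k \<le> n\<close> by (simp_all add: m_def)
      show ?thesis
      proof (cases "m \<le> j")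
        case False
        then show ?thesis
          using True by (simp add: m int_choose_def binomial_eq_0 flip: m_def)
      next
        case mj: True
        \<comment> \<open>Both integer exponents are natural numbers here, so neither power is an inverse.\<close>
        then have "2 * int j + int k - int n = int (j - m)"
          using m(2) by simp
        then show ?thesis
          using True by (simp only: m(1)) (simp add: int_choose_def mult_ac flip: m_def)
      qed
    qed
  qed
  finally show ?thesis .
qed

end
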